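(* There is an absolute constant $c>0$ such that the following holds. Suppose that $M\geq 1$. Then there is a finite Abelian group $G$ and a function $f:G\to\mathbb{Z}$ with $\|f\|_{A(G)}\leq M$ such that for every $z:\mathcal{W}(G)\to\mathbb{Z}$ with $$f=\sum_{W\in\mathcal{W}(G)}z(W)1_W$$ we have $$\|z\|_{\ell_1(\mathcal{W}(G))}\geq c\exp\left(\frac{\pi^2}{4}M\right).$$
   Context: For a finite Abelian group $G$, $\widehat{G}$ is the group of homomorphisms $G\to S^1$, $m_G$ is the Haar probability measure on $G$ (mass $|G|^{-1}$ at each point), $\widehat{f}(\gamma)=\int f(x)\overline{\gamma(x)}\,dm_G(x)$, and $\|f\|_{A(G)}=\sum_{\gamma\in\widehat{G}}|\widehat{f}(\gamma)|$. $\mathcal{W}(G)=\bigcup_{H\leq G}G/H$ is the set of all cosets of subgroups of $G$; $1_W$ is the indicator function of $W$; $\|z\|_{\ell_1(\mathcal{W}(G))}=\sum_{W}|z(W)|$. The paper writes the bound as $\Omega(\exp(\frac{\pi^2}{4}M))$, where $g=\Omega(h)$ means $h=O(g)$. *)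

theory Defs
  imports "HOL-Probability.Probability" "HOL-Algebra.Coset"
begin

definition circle_group :: "complex monoid" where
  "circle_group = \<lparr>carrier = sphere 0 1, mult = (*), one = 1\<rparr>"

text \<open>Characters are homomorphisms on the carrier; restricting to extensional functions makes
  each of them correspond to exactly one HOL function.\<close>

definition characters :: "('a, 'b) monoid_scheme \<Rightarrow> ('a \<Rightarrow> complex) set" where
  "characters G = hom G circle_group \<inter> extensional (carrier G)"

text \<open>The definitions below are meant for finite commutative groups: the uniform measure is the
  Haar probability measure only when the carrier is finite, and a HOL sum over an infinite set
  is 0.\<close>

definition fourier :: "('a, 'b) monoid_scheme \<Rightarrow> ('a \<Rightarrow> complex) \<Rightarrow> ('a \<Rightarrow> complex) \<Rightarrow> complex" where
  "fourier G f \<gamma> = (LINT x | uniform_count_measure (carrier G). f x * cnj (\<gamma> x))"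

definition A_norm :: "('a, 'b) monoid_scheme \<Rightarrow> ('a \<Rightarrow> complex) \<Rightarrow> real" where
  "A_norm G f = (\<Sum>\<gamma>\<in>characters G. cmod (fourier G f \<gamma>))"

definition all_cosets :: "('a, 'b) monoid_scheme \<Rightarrow> 'a set set" where
  "all_cosets G = (\<Union>H\<in>{H. subgroup H G}. rcosets\<^bsub>G\<^esub> H)"

definition l1_norm :: "('a, 'b) monoid_scheme \<Rightarrow> ('a set \<Rightarrow> int) \<Rightarrow> real" where
  "l1_norm G z = real_of_int (\<Sum>W\<in>all_cosets G. \<bar>z W\<bar>)"

text \<open>Functions on a group \<open>G\<close> and on its set of cosets are represented by total HOL functions;
  only their values on \<open>carrier G\<close>, respectively \<open>all_cosets G\<close>, matter. When a finite group has
  to be asserted to exist, it is taken with a carrier of integers, which is no restriction: every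
  finite group is isomorphic to such a group.\<close>

end

theory Submission
  imports Defs "HOL-Real_Asymp.Real_Asymp" "HOL-Algebra.Elementary_Groups"
begin

text \<open>Take $G = \mathbf{Z}/p$ with $p = 2n + 1$ prime and $f$ the indicator function of
  $\{0, \ldots, n - 1\}$. The cosets in $G$ are the points and $G$ itself, so pairing $f$ with the
  function that is $1$ on $[0, n)$, $-1$ on $[n, 2n)$ and $0$ at $2n$ shows that $z$ has norm at
  least $n$. For intervals of about half the group the Fourier coefficients are explicit:
  writing the frequencies as $2s$ with $|s| \le n$, they have modulus
  $1 / (2 p \cos(\pi s / p))$ for $s \neq 0$, whence the algebra norm of $f$ is at most
  $\frac{1}{\pi} \ln p + O(1)$. This is better than the $\frac{4}{\pi^2} \ln p$ that is
  needed, and the slack makes it enough to find a prime in $(N^{\pi/4}, N]$ for every large $N$,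
  with $N$ about $\exp(\pi M)$. Such a prime exists because otherwise the prime
  factorisation of the central binomial coefficient near $N$ would be at most
  $N^{N^{\pi/4}}$.\<close>

subsection \<open>Primes in long intervals\<close>

text \<open>Legendre's formula, by induction: passing from n to n + 1 raises
  \<open>n div p ^ i\<close> by one exactly when \<open>p ^ i\<close> divides n + 1, and the number
  of such i >= 1 is the multiplicity of p in n + 1. The bound \<open>n < p ^ Suc K\<close> ensures
  that cutting off at K loses nothing.\<close>

lemma multiplicity_fact:
  fixes p :: nat
  assumes "prime p" "n < p ^ Suc K"
  shows "multiplicity p (fact n :: nat) = (\<Sum>i=1..K. n div p ^ i)"
  using assms(2)
proof (induction n)
  case (Suc n)
  have dvd_iff: "p ^ i dvd Suc n \<longleftrightarrow> i \<le> multiplicity p (Suc n)" for i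
    using assms(1) by (intro power_dvd_iff_le_multiplicity) (auto simp: not_prime_unit)
  have "multiplicity p (Suc n) \<le> K"
  proof -
    have "p ^ multiplicity p (Suc n) \<le> Suc n"
      by (intro dvd_imp_le multiplicity_dvd) auto
    hence "p ^ multiplicity p (Suc n) < p ^ Suc K"
      using Suc.prems by linarith
    thus ?thesis
      using prime_gt_1_nat[OF assms(1)] by (simp del: power_Suc)
  qed
  hence "{i\<in>{1..K}. p ^ i dvd Suc n} = {1..multiplicity p (Suc n)}"
    unfolding dvd_iff by auto
  hence eq: "multiplicity p (Suc n) = (\<Sum>i=1..K. if p ^ i dvd Suc n then 1 else 0)"
    by (simp flip: sum.inter_filter)
  have "Suc n div p ^ i = n div p ^ i + (if p ^ i dvd Suc n then 1 else 0)" for i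
    by (auto simp: div_Suc mod_eq_0_iff_dvd)
  hence "(\<Sum>i=1..K. Suc n div p ^ i) = multiplicity p (fact n :: nat) + multiplicity p (Suc n)"
    using Suc by (simp add: sum.distrib eq)
  also have "\<dots> = multiplicity p (fact (Suc n) :: nat)"
    using assms(1) by (simp add: fact_Suc prime_elem_multiplicity_mult_distrib del: of_nat_Suc mult_Suc)
  finally show ?case ..
qed simp

text \<open>By Legendre's formula the exponent of p is the sum of floor(2m/p^i) - 2 floor(m/p^i)
  over i from 1 to K, where K is maximal with p^K <= 2m. Each term is at most 1, so the exponent is
  at most K.\<close>

lemma power_multiplicity_central_binomial_le:
  fixes p m :: nat
  assumes "prime p" "m > 0"
  shows "p ^ multiplicity p (2 * m choose m) \<le> 2 * m"
proof -
  have p: "p > 1" using assms(1) by (rule prime_gt_1_nat)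
  obtain K where K: "p ^ K \<le> 2 * m" "2 * m < p ^ Suc K"
    using ex_power_ivl1[of p "2 * m"] p assms(2) by auto
  let ?C = "2 * m choose m"
  have "fact m * fact m * ?C = (fact (2 * m) :: nat)"
    using binomial_fact_lemma[of m "2 * m"] by simp
  hence "multiplicity p (fact (2 * m) :: nat) = multiplicity p (fact m * fact m * ?C)"
    by simp
  also have "\<dots> = 2 * multiplicity p (fact m :: nat) + multiplicity p ?C"
    using assms(1) by (simp add: prime_elem_multiplicity_mult_distrib)
  finally have "multiplicity p ?C + (\<Sum>i=1..K. 2 * (m div p ^ i)) = (\<Sum>i=1..K. 2 * m div p ^ i)"
    using multiplicity_fact[OF assms(1), of "2 * m" K] multiplicity_fact[OF assms(1), of m K] K
    by (simp add: sum_distrib_left)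
  also have "\<dots> \<le> (\<Sum>i=1..K. 2 * (m div p ^ i) + 1)"
  proof (rule sum_mono)
    fix i
    have "m mod p ^ i < p ^ i" using p by simp
    hence "2 * m < 2 * (p ^ i * (m div p ^ i)) + 2 * p ^ i"
      using mult_div_mod_eq[of "p ^ i" m] by linarith
    also have "\<dots> = (2 * (m div p ^ i) + 2) * p ^ i"
      by (simp add: algebra_simps)
    finally have "2 * m div p ^ i < 2 * (m div p ^ i) + 2"
      by (rule less_mult_imp_div_less)
    thus "2 * m div p ^ i \<le> 2 * (m div p ^ i) + 1" by simp
  qed
  also have "\<dots> = (\<Sum>i=1..K. 2 * (m div p ^ i)) + K"
    by (simp only: sum.distrib) simp
  finally have "multiplicity p ?C \<le> K"
    by linarith
  hence "p ^ multiplicity p ?C \<le> p ^ K"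
    using p by simp
  thus ?thesis using K by linarith
qed

lemma ex_prime_between_powr:
  assumes "0 < \<theta>" "\<theta> < 1"
  shows "\<forall>\<^sub>F N in sequentially. \<exists>p::nat. prime p \<and> real N powr \<theta> < real p \<and> p \<le> N"
proof -
  \<comment> \<open>This contradicts the logarithm of 4^m <= N C combined with C <= N^(N^\<theta>),
    where m = N div 2 and C is the central binomial coefficient. The summand 1 pays for the factor N
    in front of C, and N - 1 <= 2m allows for odd N.\<close>
  have "\<forall>\<^sub>F N in sequentially. (real N - 1) * ln 2 > (1 + real N powr \<theta>) * ln (real N)"
    using assms by real_asymp
  moreover have "\<forall>\<^sub>F N in sequentially. N \<ge> (2::nat)"
    by (rule eventually_ge_at_top)
  ultimately show ?thesis
  proof eventually_elim
    case (elim N)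
    show ?case
    proof (rule ccontr)
      assume contra: "\<not> ?thesis"
      define m where "m = N div 2"
      define C where "C = 2 * m choose m"
      have m: "m > 0" "2 * m \<le> N" "N \<le> 2 * m + 1"
        using elim(2) by (auto simp: m_def)
      have C: "C > 0" by (simp add: C_def)
      \<comment> \<open>Bounding the number of prime factors by the number of all positive integers
        up to N^\<theta> is crude but suffices because \<theta> < 1.\<close>
      have "p \<in> {1..nat \<lfloor>real N powr \<theta>\<rfloor>}" if p: "p \<in> prime_factors C" for p
      proof -
        have "prime p" and "p dvd C" using p by auto
        have "p dvd fact (2 * m)"
          using \<open>p dvd C\<close> binomial_fact_lemma[of m "2 * m"] unfolding C_def
          by (metis dvd_mult le_add1 mult_2)
        hence "p \<le> N"
          using \<open>prime p\<close> m by (simp add: prime_dvd_fact_iff)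
        hence "real p \<le> real N powr \<theta>"
          using contra \<open>prime p\<close> by (meson not_le)
        thus ?thesis
          using prime_gt_0_nat[OF \<open>prime p\<close>] by (simp add: le_nat_floor)
      qed
      hence "card (prime_factors C) \<le> nat \<lfloor>real N powr \<theta>\<rfloor>"
        using card_mono[of "{1..nat \<lfloor>real N powr \<theta>\<rfloor>}" "prime_factors C"] by (simp add: subsetI)
      hence card: "real (card (prime_factors C)) \<le> real N powr \<theta>"
        by (meson of_nat_floor of_nat_le_iff order_trans powr_ge_zero)
      have "C = (\<Prod>p\<in>prime_factors C. p ^ multiplicity p C)"
        using C prod_prime_factors[of C] by simp
      also have "\<dots> \<le> (\<Prod>p\<in>prime_factors C. N)"
      proof (intro prod_mono conjI)
        fix p assume "p \<in> prime_factors C"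
        hence "prime p" by auto
        thus "p ^ multiplicity p C \<le> N"
          using power_multiplicity_central_binomial_le[of p m] m unfolding C_def by linarith
      qed simp
      finally have "real C \<le> real N ^ card (prime_factors C)"
        by (metis of_nat_le_iff of_nat_power prod_constant)
      hence "ln (real C) \<le> ln (real N ^ card (prime_factors C))"
        using C elim(2) by (subst ln_le_cancel_iff) auto
      also have "\<dots> = real (card (prime_factors C)) * ln (real N)"
        using elim(2) by (simp add: ln_realpow)
      also have "\<dots> \<le> real N powr \<theta> * ln (real N)"
        using card elim(2) by (intro mult_right_mono) auto
      finally have upper: "ln (real C) \<le> real N powr \<theta> * ln (real N)" .
      have "(real N - 1) * ln 2 \<le> real (2 * m) * ln 2"
        using m by (intro mult_right_mono) auto
      also have "\<dots> = ln (4 ^ m :: real)"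
        using ln_realpow[of 2 "2 * m"] by (simp add: power_mult)
      also have "(4 ^ m :: real) \<le> real N * real C"
      proof -
        have "4 ^ m \<le> 2 * real m * real C"
          using central_binomial_lower_bound[OF m(1)] m(1) unfolding C_def by (simp add: field_simps)
        also have "\<dots> \<le> real N * real C"
          using m(2) by (intro mult_right_mono) auto
        finally show ?thesis .
      qed
      hence "ln (4 ^ m :: real) \<le> ln (real N * real C)"
        using C elim(2) by (subst ln_le_cancel_iff) auto
      also have "\<dots> = ln (real N) + ln (real C)"
        using C elim(2) by (simp add: ln_mult)
      finally show False
        using upper elim(1) by (simp add: algebra_simps)
    qed
  qed
qed

subsection \<open>Trigonometric sums\<close>

text \<open>With y = x/2, the inequality y <= tan y gives sin x = 2 tan y cos^2 y >= x (1 - sin^2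
  y). Since sin^2 y <= 1/2, this yields sin x >= x/2; since sin y <= y, it yields x - sin x <= x^3/4
  <= x sin x. Dividing by x sin x gives the claim.\<close>

lemma inverse_sin_le:
  fixes x :: real
  assumes "0 < x" "x < pi / 2"
  shows "1 / sin x \<le> 1 / x + 1"
proof -
  define y where "y = x / 2"
  have y: "0 < y" "y < pi / 4" using assms by (auto simp: y_def)
  have "0 < cos y" using y by (intro cos_gt_zero) auto
  have "sin y \<le> y" using y by (intro sin_x_le_x) auto
  have "sin y \<ge> 0" using y by (intro sin_ge_zero) auto
  have "sin y \<le> sin (pi / 4)" using y by (intro sin_monotone_2pi_le) auto
  hence "(sin y)\<^sup>2 \<le> (sin (pi / 4))\<^sup>2" using \<open>sin y \<ge> 0\<close> by (rule power_mono)
  hence half: "(sin y)\<^sup>2 \<le> 1 / 2" by (simp add: sin_45 power_divide)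
  have sqr: "(sin y)\<^sup>2 \<le> y\<^sup>2" using \<open>sin y \<le> y\<close> \<open>sin y \<ge> 0\<close> by (rule power_mono)
  have "y \<le> tan y" using abs_tan_ge[of y] y tan_gt_zero[of y] by auto
  hence "y * cos y \<le> sin y" using \<open>0 < cos y\<close> by (simp add: tan_def field_simps)
  hence "2 * (y * cos y) * cos y \<le> 2 * sin y * cos y"
    using \<open>0 < cos y\<close> by (intro mult_right_mono) auto
  moreover have "x * (1 - (sin y)\<^sup>2) = 2 * (y * cos y) * cos y"
    unfolding cos_squared_eq[symmetric] by (simp add: y_def power2_eq_square)
  moreover have "sin x = 2 * sin y * cos y"
    using sin_double[of y] by (simp add: y_def)
  ultimately have lower: "x * (1 - (sin y)\<^sup>2) \<le> sin x"
    by simp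
  have "x * (1 / 2) \<le> x * (1 - (sin y)\<^sup>2)" using assms half by (intro mult_left_mono) auto
  hence sin_ge: "x / 2 \<le> sin x" using lower by linarith
  have "x - sin x \<le> x * (sin y)\<^sup>2" using lower by (simp add: algebra_simps)
  also have "\<dots> \<le> x * y\<^sup>2" using sqr assms by (intro mult_left_mono) auto
  also have "\<dots> = x * (x / 2) * (x / 2)" by (simp add: y_def power2_eq_square)
  also have "\<dots> \<le> x * (x / 2) * 1"
    using assms pi_less_4 by (intro mult_left_mono) auto
  also have "\<dots> \<le> x * sin x" using sin_ge assms by simp
  finally show ?thesis using sin_ge assms by (simp add: field_simps)
qed

lemma sum_inverse_odd_le:
  "(\<Sum>t<n. 1 / real (2 * t + 1)) \<le> 1 + ln (real (2 * n + 1)) / 2"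
proof (cases n)
  case (Suc m)
  \<comment> \<open>The induction carries a logarithm with argument 2n - 1 instead of 2n + 1. With
    2n + 1 the step would fail, as the new term 1/(2n + 1) exceeds the growth of the right-hand
    side; after the shift, ln u <= u - 1 points the right way.\<close>
  have "(\<Sum>t<Suc m. 1 / real (2 * t + 1)) \<le> 1 + ln (real (2 * m + 1)) / 2"
  proof (induction m)
    case (Suc m)
    have "ln (real (2 * m + 1) / real (2 * m + 3)) \<le> real (2 * m + 1) / real (2 * m + 3) - 1"
      by (intro ln_le_minus_one) auto
    hence "ln (real (2 * m + 1)) - ln (real (2 * m + 3)) \<le> - (2 / real (2 * m + 3))"
      by (subst (asm) ln_div) (auto simp: field_simps)
    moreover have "2 * Suc m + 1 = 2 * m + 3" by simp
    ultimately show ?case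
      using Suc by (simp only: sum.lessThan_Suc[of _ "Suc m"])
  qed simp
  also have "ln (real (2 * m + 1)) \<le> ln (real (2 * n + 1))"
    using Suc by (subst ln_le_cancel_iff) auto
  finally show ?thesis using Suc by simp
qed simp

text \<open>The large terms are those with s near n. Substituting t = n - s turns the cosines into
  sines of the angles pi (2t + 1)/(2p), where 1/sin x <= 1/x + 1 leaves a sum of inverse odd
  numbers. The constant 3/2 absorbs 2/pi <= 1 and n <= p/2.\<close>

lemma sum_inverse_cos_le:
  fixes n :: nat
  defines "p \<equiv> real (2 * n + 1)"
  shows "(\<Sum>s=1..n. 1 / cos (pi * real s / p)) \<le> p * (3 / 2 + ln p / pi)"
proof -
  have p: "p > 0" by (simp add: p_def)
  have "(\<Sum>s=1..n. 1 / cos (pi * real s / p)) = (\<Sum>t<n. 1 / sin (pi * real (2 * t + 1) / (2 * p)))"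
  proof (rule sum.reindex_bij_witness[of _ "\<lambda>t. n - t" "\<lambda>s. n - s"])
    fix s assume s: "s \<in> {1..n}"
    have "pi * real (2 * (n - s) + 1) / (2 * p) = pi / 2 - pi * real s / p"
      using s p by (simp add: of_nat_diff field_simps) (simp add: p_def algebra_simps)
    thus "1 / sin (pi * real (2 * (n - s) + 1) / (2 * p)) = 1 / cos (pi * real s / p)"
      by (simp add: sin_cos_eq)
  qed auto
  also have "\<dots> \<le> (\<Sum>t<n. 2 * p / pi * (1 / real (2 * t + 1)) + 1)"
  proof (rule sum_mono)
    fix t assume "t \<in> {..<n}"
    hence "pi * real (2 * t + 1) / (2 * p) < pi / 2"
      using p by (simp add: divide_simps p_def)
    hence "1 / sin (pi * real (2 * t + 1) / (2 * p)) \<le> 1 / (pi * real (2 * t + 1) / (2 * p)) + 1"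
      using p by (intro inverse_sin_le) auto
    thus "1 / sin (pi * real (2 * t + 1) / (2 * p)) \<le> 2 * p / pi * (1 / real (2 * t + 1)) + 1"
      by simp
  qed
  also have "\<dots> = 2 * p / pi * (\<Sum>t<n. 1 / real (2 * t + 1)) + real n"
    by (simp only: sum.distrib sum_distrib_left) simp
  also have "\<dots> \<le> 2 * p / pi * (1 + ln p / 2) + p / 2"
    using sum_inverse_odd_le[of n] p by (intro add_mono mult_left_mono) (auto simp: p_def)
  also have "\<dots> = p * (2 / pi + 1 / 2 + ln p / pi)"
    by (simp add: field_simps)
  also have "\<dots> \<le> p * (3 / 2 + ln p / pi)"
    using p pi_ge_two by (intro mult_left_mono) (auto simp: field_simps)
  finally show ?thesis .
qed

text \<open>With \<theta> = pi s/p, the geometric sum has modulus |sin(2n \<theta>)| / |sin(2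
  \<theta>)|. Since 2n = p - 1, the angle 2n \<theta> is pi s - \<theta>, so the numerator is |sin
  \<theta>| and cancels against the double-angle formula below. This cancellation is the reason for
  writing frequencies as 2s.\<close>

lemma norm_sum_cis_half:
  fixes n :: nat and s :: int
  defines "p \<equiv> real (2 * n + 1)"
  assumes "s \<noteq> 0" "\<bar>s\<bar> \<le> int n"
  shows "cmod (\<Sum>x<n. cis (4 * pi * s / p) ^ x) = 1 / (2 * cos (pi * s / p))"
proof -
  define \<theta> where "\<theta> = pi * s / p"
  have p: "p > 0" by (simp add: p_def)
  have "2 * \<bar>real_of_int s\<bar> < p"
    using assms(3) unfolding p_def by linarith
  hence \<theta>: "\<bar>\<theta>\<bar> < pi / 2" "\<theta> \<noteq> 0"
    using p assms(2) by (auto simp: \<theta>_def abs_mult field_simps)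
  have cos: "cos \<theta> > 0"
    using \<theta> by (intro cos_gt_zero_pi) auto
  have sin: "sin \<theta> \<noteq> 0"
    using sin_zero_pi_iff[of \<theta>] \<theta> by auto
  have norm: "cmod (cis (4 * \<theta>) ^ k - 1) = 2 * \<bar>sin (2 * real k * \<theta>)\<bar>" for k
    using dist_exp_i_1[of "real k * (4 * \<theta>)"] unfolding Complex.DeMoivre by (simp add: cis_conv_exp mult_ac)
  have "2 * real n * \<theta> = pi * of_int s - \<theta>"
    using p by (simp add: \<theta>_def field_simps) (simp add: p_def algebra_simps)
  hence "\<bar>sin (2 * real n * \<theta>)\<bar> = \<bar>sin \<theta>\<bar>"
    by (simp add: sin_diff sin_npi_int cos_npi_int)
  moreover have "cis (4 * \<theta>) \<noteq> 1"
    using norm[of 1] sin cos by (auto simp: sin_double)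
  ultimately have "cmod (\<Sum>x<n. cis (4 * \<theta>) ^ x) = 2 * \<bar>sin \<theta>\<bar> / (2 * \<bar>sin (2 * \<theta>)\<bar>)"
    using norm[of n] norm[of 1] by (simp add: geometric_sum norm_divide)
  moreover have "4 * pi * of_int s / p = 4 * \<theta>" by (simp add: \<theta>_def)
  ultimately show ?thesis
    using sin cos by (simp add: sin_double abs_mult flip: \<theta>_def)
qed

subsection \<open>Fourier coefficients and cosets in cyclic groups\<close>

lemma characters_integer_mod_groupE:
  assumes "\<gamma> \<in> characters (integer_mod_group n)" "n > 0"
  obtains w where "w ^ n = 1" "\<And>x. x \<in> {0..<int n} \<Longrightarrow> \<gamma> x = w ^ nat x"
proof -
  \<comment> \<open>The reduction modulo n matters for n = 1, where 1 itself lies outside the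
    carrier.\<close>
  define w where "w = \<gamma> (1 mod int n)"
  have mult: "\<gamma> ((x + y) mod int n) = \<gamma> x * \<gamma> y" if "x \<in> {0..<int n}" "y \<in> {0..<int n}" for x y
    using assms that by (auto simp: characters_def hom_def circle_group_def carrier_integer_mod_group)
  have "cmod (\<gamma> 0) = 1"
    using assms by (auto simp: characters_def hom_def circle_group_def carrier_integer_mod_group Pi_iff)
  hence one: "\<gamma> 0 = 1"
    using mult[of 0 0] assms(2) by auto
  have pow: "\<gamma> (int k mod int n) = w ^ k" for k
  proof (induction k)
    case (Suc k)
    have "int (Suc k) mod int n = (int k mod int n + 1 mod int n) mod int n"
      by (simp add: mod_simps add.commute)
    thus ?case
      using mult[of "int k mod int n" "1 mod int n"] Suc assms(2) by (simp add: w_def)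
  qed (simp add: one)
  show ?thesis
  proof
    show "w ^ n = 1" using pow[of n] one by simp
    show "\<gamma> x = w ^ nat x" if "x \<in> {0..<int n}" for x
      using pow[of "nat x"] that by simp
  qed
qed

text \<open>As 2 is invertible modulo 2n + 1, every frequency k is congruent to some 2s: take s = j
  for k = 2j, and s = j - n for k = 2j + 1, because 2(j - n) = k - (2n + 1).\<close>

lemma root_of_unity_eq_cis_double:
  fixes w :: complex
  assumes "w ^ (2 * n + 1) = 1"
  obtains s :: int where "\<bar>s\<bar> \<le> int n" "w = cis (4 * pi * s / real (2 * n + 1))"
proof -
  let ?p = "2 * n + 1"
  have "w \<in> (\<lambda>k. cis (2 * pi * real k / real ?p)) ` {..<?p}"
    using bij_betw_imp_surj_on[OF Complex.bij_betw_roots_unity[of ?p]] assms by simp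
  then obtain k where "k \<in> {..<?p}" and k: "w = cis (2 * pi * real k / real ?p)"
    by (rule imageE)
  show ?thesis
  proof (cases "even k")
    case True
    then obtain j where "k = 2 * j" ..
    thus ?thesis using k \<open>k \<in> {..<?p}\<close> by (intro that[of "int j"]) (auto simp: mult_ac)
  next
    case False
    then obtain j where j: "k = 2 * j + 1" by (rule oddE)
    have "4 * pi * (real j - real n) / real ?p = 2 * pi * real k / real ?p - 2 * pi"
      by (simp add: j field_simps)
    hence "cis (4 * pi * (real j - real n) / real ?p) = w"
      by (simp add: k flip: cis_divide)
    thus ?thesis using \<open>k \<in> {..<?p}\<close> j by (intro that[of "int j - int n"]) auto
  qed
qed

lemma fourier_finite:
  assumes "finite (carrier G)" "carrier G \<noteq> {}"
  shows "fourier G f \<gamma> = (\<Sum>x\<in>carrier G. f x * cnj (\<gamma> x)) / of_nat (card (carrier G))"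
proof -
  have "card (carrier G) > 0" using assms by (simp add: card_gt_0_iff)
  hence "(1 :: ennreal) / of_nat (card (carrier G)) = ennreal (1 / real (card (carrier G)))"
    by (simp add: ennreal_of_nat_eq_real_of_nat divide_ennreal[symmetric])
  hence "fourier G f \<gamma> = (\<Sum>x\<in>carrier G. (1 / real (card (carrier G))) *\<^sub>R (f x * cnj (\<gamma> x)))"
    using assms unfolding fourier_def uniform_count_measure_def
    by (simp add: lebesgue_integral_point_measure_finite)
  thus ?thesis
    by (simp add: scaleR_conv_of_real sum_divide_distrib)
qed

lemma sum_symmetric_int_interval:
  fixes g :: "int \<Rightarrow> 'a :: comm_monoid_add"
  shows "(\<Sum>s=-int n..int n. g s) = g 0 + (\<Sum>s=1..n. g (int s) + g (- int s))"
proof (induction n)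
  case (Suc n)
  have "{- int (Suc n)..int (Suc n)} = insert (int (Suc n)) (insert (- int (Suc n)) {- int n..int n})"
    by auto
  thus ?case by (simp add: Suc add_ac)
qed simp

text \<open>By Lagrange's theorem a subgroup has order 1 or p, so it is trivial or
  everything.\<close>

lemma coset_integer_mod_group_prime:
  assumes "prime p" "W \<in> all_cosets (integer_mod_group p)"
  obtains x where "x \<in> {0..<int p}" "W = {x}" | "W = {0..<int p}"
proof -
  let ?G = "integer_mod_group p"
  interpret group ?G by simp
  have p: "p > 0" using assms(1) by (rule prime_gt_0_nat)
  have carrier: "carrier ?G = {0..<int p}" using p by (simp add: carrier_integer_mod_group)
  obtain H a where H: "subgroup H ?G" and a: "a \<in> carrier ?G" and W: "W = H #>\<^bsub>?G\<^esub> a"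
    using assms(2) by (auto simp: all_cosets_def RCOSETS_def)
  have finH: "finite H" using subgroup.subset[OF H] carrier finite_subset by auto
  have "card (rcosets\<^bsub>?G\<^esub> H) * card H = p"
    using lagrange[OF H] by (simp add: order_def carrier)
  hence "card H dvd p" by (metis dvd_triv_right)
  hence "card H = 1 \<or> card H = p" using assms(1) by (simp add: prime_nat_iff)
  thus ?thesis
  proof
    assume "card H = 1"
    hence "H = {\<one>\<^bsub>?G\<^esub>}"
      using subgroup.one_closed[OF H] by (auto simp: card_1_singleton_iff)
    hence "W = {a}" using a W by (auto simp: r_coset_def carrier)
    thus ?thesis using that(1) a carrier by simp
  next
    assume "card H = p"
    hence "H = carrier ?G"
      using subgroup.subset[OF H] carrier by (intro card_subset_eq) auto
    hence "W = carrier ?G" using W a coset_join2 subgroup_self by auto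
    thus ?thesis using that(2) carrier by simp
  qed
qed

text \<open>Duality: a test function \<phi> whose sum over each coset is at most 1 in modulus bounds
  the norm of every representation of f from below. Exchanging the two sums turns the pairing of f
  with \<phi> into the sum of z(W) times the sum of \<phi> over W.\<close>

lemma sum_le_l1_norm:
  fixes z :: "'a set \<Rightarrow> int" and f \<phi> :: "'a \<Rightarrow> int"
  assumes "group G" and fin: "finite (carrier G)"
    and f: "\<And>x. x \<in> carrier G \<Longrightarrow> f x = (\<Sum>W\<in>all_cosets G. z W * indicator W x)"
    and \<phi>: "\<And>W. W \<in> all_cosets G \<Longrightarrow> \<bar>\<Sum>x\<in>W. \<phi> x\<bar> \<le> 1"
  shows "of_int (\<Sum>x\<in>carrier G. f x * \<phi> x) \<le> l1_norm G z"
proof -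
  have "(\<Sum>x\<in>carrier G. f x * \<phi> x)
      = (\<Sum>x\<in>carrier G. \<Sum>W\<in>all_cosets G. z W * (indicator W x * \<phi> x))"
    by (intro sum.cong) (simp_all add: f sum_distrib_right mult.assoc)
  also have "\<dots> = (\<Sum>W\<in>all_cosets G. z W * (\<Sum>x\<in>carrier G. indicator W x * \<phi> x))"
    by (subst sum.swap) (simp add: sum_distrib_left)
  also have "\<dots> = (\<Sum>W\<in>all_cosets G. z W * (\<Sum>x\<in>W. \<phi> x))"
  proof (intro sum.cong refl)
    fix W assume "W \<in> all_cosets G"
    hence "{x \<in> carrier G. x \<in> W} = W"
      using group.rcosets_subset_PowG[OF \<open>group G\<close>] by (fastforce simp: all_cosets_def)
    thus "z W * (\<Sum>x\<in>carrier G. indicator W x * \<phi> x) = z W * (\<Sum>x\<in>W. \<phi> x)"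
      using fin by (simp add: sum_indicator_mult)
  qed
  also have "\<dots> \<le> (\<Sum>W\<in>all_cosets G. \<bar>z W\<bar>)"
  proof (rule sum_mono)
    fix W assume "W \<in> all_cosets G"
    hence "\<bar>z W\<bar> * \<bar>\<Sum>x\<in>W. \<phi> x\<bar> \<le> \<bar>z W\<bar> * 1"
      by (intro mult_left_mono \<phi>) auto
    thus "z W * (\<Sum>x\<in>W. \<phi> x) \<le> \<bar>z W\<bar>"
      by (metis abs_ge_self abs_mult mult.right_neutral order_trans)
  qed
  finally show ?thesis unfolding l1_norm_def of_int_le_iff .
qed

lemma A_norm_interval_le:
  fixes n :: nat
  defines "p \<equiv> 2 * n + 1"
  shows "A_norm (integer_mod_group p) (\<lambda>x. of_int (indicator {0..<int n} x))
    \<le> (real n + (\<Sum>s=1..n. 1 / cos (pi * real s / real p))) / real p"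
proof -
  let ?G = "integer_mod_group p" and ?f = "\<lambda>x. of_int (indicator {0..<int n} x) :: complex"
  have p: "p > 0" by (simp add: p_def)
  have carrier: "carrier ?G = {0..<int p}" using p by (simp add: carrier_integer_mod_group)
  define w where "w s = cis (4 * pi * of_int s / real p)" for s :: int
  \<comment> \<open>Restriction to the carrier matches the extensionality built into
    \<open>characters\<close>.\<close>
  define \<psi> where "\<psi> s = restrict (\<lambda>x. w s ^ nat x) {0..<int p}" for s
  have fourier: "cmod (fourier ?G ?f (\<psi> s)) = cmod (\<Sum>k<n. w s ^ k) / real p" for s
  proof -
    have "(\<Sum>x\<in>{0..<int p}. ?f x * cnj (\<psi> s x)) = (\<Sum>x\<in>{0..<int n}. cnj (w s ^ nat x))"
      by (intro sum.mono_neutral_cong_right) (auto simp: \<psi>_def p_def indicator_def)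
    also have "\<dots> = (\<Sum>k<n. cnj (w s ^ k))"
      by (rule sum.reindex_bij_witness[of _ int nat]) auto
    also have "\<dots> = cnj (\<Sum>k<n. w s ^ k)" by simp
    finally show ?thesis
      using p by (simp add: fourier_finite carrier norm_divide del: cnj_sum complex_cnj_power)
  qed
  have "characters ?G \<subseteq> \<psi> ` {- int n..int n}"
  proof
    fix \<gamma> assume \<gamma>: "\<gamma> \<in> characters ?G"
    obtain u where u: "u ^ p = 1" "\<And>x. x \<in> {0..<int p} \<Longrightarrow> \<gamma> x = u ^ nat x"
      using characters_integer_mod_groupE[OF \<gamma> p] by blast
    obtain s where s: "\<bar>s\<bar> \<le> int n" "u = w s"
      using root_of_unity_eq_cis_double[of u n] u(1) unfolding w_def p_def by metis
    have "\<gamma> \<in> extensional {0..<int p}" using \<gamma> by (simp add: characters_def carrier)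
    hence "\<gamma> = \<psi> s"
      by (rule extensionalityI) (auto simp: \<psi>_def u s)
    thus "\<gamma> \<in> \<psi> ` {- int n..int n}" using s by (intro image_eqI[of _ _ s]) auto
  qed
  \<comment> \<open>For an upper bound it is enough that the \<psi> s cover all characters, since
    repetitions only enlarge a sum of nonnegative terms. The frequency s = 0 contributes n/p, and
    each pair s, -s contributes two equal terms.\<close>
  hence "A_norm ?G ?f \<le> (\<Sum>\<gamma>\<in>\<psi> ` {- int n..int n}. cmod (fourier ?G ?f \<gamma>))"
    unfolding A_norm_def by (intro sum_mono2) auto
  also have "\<dots> \<le> (\<Sum>s=-int n..int n. cmod (fourier ?G ?f (\<psi> s)))"
    using sum_image_le[of "{- int n..int n}" "\<lambda>\<gamma>. cmod (fourier ?G ?f \<gamma>)" \<psi>] by (simp add: o_def)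
  also have "\<dots> = (\<Sum>s=-int n..int n. cmod (\<Sum>k<n. w s ^ k)) / real p"
    by (simp add: fourier sum_divide_distrib)
  also have "(\<Sum>s=-int n..int n. cmod (\<Sum>k<n. w s ^ k))
    = real n + (\<Sum>s=1..n. cmod (\<Sum>k<n. w (int s) ^ k) + cmod (\<Sum>k<n. w (- int s) ^ k))"
    by (subst sum_symmetric_int_interval) (simp add: w_def)
  also have "(\<Sum>s=1..n. cmod (\<Sum>k<n. w (int s) ^ k) + cmod (\<Sum>k<n. w (- int s) ^ k))
    = (\<Sum>s=1..n. 1 / cos (pi * real s / real p))"
  proof (intro sum.cong refl)
    fix s assume s: "s \<in> {1..n}"
    have "cmod (\<Sum>k<n. w (int s) ^ k) = 1 / (2 * cos (pi * real s / real p))"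
      using norm_sum_cis_half[of "int s" n] s unfolding w_def p_def by simp
    moreover have "cmod (\<Sum>k<n. w (- int s) ^ k) = 1 / (2 * cos (pi * real s / real p))"
      using norm_sum_cis_half[of "- int s" n] s unfolding w_def p_def by simp
    ultimately show "cmod (\<Sum>k<n. w (int s) ^ k) + cmod (\<Sum>k<n. w (- int s) ^ k)
        = 1 / cos (pi * real s / real p)"
      by simp
  qed
  finally show ?thesis .
qed

lemma l1_norm_interval_ge:
  fixes n :: nat
  defines "p \<equiv> 2 * n + 1"
  assumes "prime p"
    and f: "\<forall>x\<in>carrier (integer_mod_group p).
      indicator {0..<int n} x = (\<Sum>W\<in>all_cosets (integer_mod_group p). z W * indicator W x)"
  shows "l1_norm (integer_mod_group p) z \<ge> real n"
proof -
  let ?G = "integer_mod_group p"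
  have carrier: "carrier ?G = {0..<int p}" by (simp add: carrier_integer_mod_group p_def)
  \<comment> \<open>Leaving out the residue 2n balances the two signs, so \<phi> sums to 0 over the
    whole group, while on a single point its modulus is at most 1.\<close>
  define \<phi> :: "int \<Rightarrow> int" where "\<phi> x = indicator {0..<int n} x - indicator {int n..<2 * int n} x" for x
  have sum_ind: "(\<Sum>x\<in>{0..<int p}. indicator B x) = int (card B)" if "B \<subseteq> {0..<int p}" for B
    using that by (simp add: indicator_def sum_of_bool_eq Int_absorb1)
  have "(\<Sum>x\<in>{0..<int p}. indicator {0..<int n} x * \<phi> x) = (\<Sum>x\<in>{0..<int p}. indicator {0..<int n} x)"
    by (intro sum.cong) (auto simp: \<phi>_def indicator_def)
  also have "\<dots> = int n" by (subst sum_ind) (auto simp: p_def)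
  finally have "int n = (\<Sum>x\<in>carrier ?G. indicator {0..<int n} x * \<phi> x)" by (simp add: carrier)
  moreover have "\<bar>\<Sum>x\<in>W. \<phi> x\<bar> \<le> 1" if "W \<in> all_cosets ?G" for W
    using \<open>prime p\<close> that
  proof (cases rule: coset_integer_mod_group_prime)
    case (1 x)
    thus ?thesis by (auto simp: \<phi>_def indicator_def)
  next
    case 2
    moreover have "(\<Sum>x\<in>{0..<int p}. \<phi> x) = 0"
      unfolding \<phi>_def sum_subtractf by (subst (1 2) sum_ind) (auto simp: p_def)
    ultimately show ?thesis by simp
  qed
  ultimately show ?thesis
    using sum_le_l1_norm[of ?G "indicator {0..<int n}" z \<phi>] f carrier
    by (metis finite_atLeastLessThan_int group_integer_mod_group of_int_of_nat_eq)
qed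

subsection \<open>The lower bound\<close>

theorem proposition1p2:
  shows "\<exists>c::real. c > 0 \<and>
    (\<forall>M::real. M \<ge> 1 \<longrightarrow>
      (\<exists>(G :: int monoid) (f :: int \<Rightarrow> int).
        comm_group G \<and> finite (carrier G) \<and>
        A_norm G (\<lambda>x. of_int (f x)) \<le> M \<and>
        (\<forall>z :: int set \<Rightarrow> int.
          (\<forall>x\<in>carrier G. f x = (\<Sum>W\<in>all_cosets G. z W * indicator W x)) \<longrightarrow>
          l1_norm G z \<ge> c * exp (pi\<^sup>2 / 4 * M))))"
proof -
  let ?f = "\<lambda>n. indicator {0..<int n} :: int \<Rightarrow> int"
  \<comment> \<open>The target exp(pi^2 M/4) is (exp(pi M))^\<theta> for this \<theta>; hence p >
    N^\<theta> with N of order exp(pi M) is large enough.\<close>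
  define \<theta> where "\<theta> = pi / 4"
  have \<theta>: "0 < \<theta>" "\<theta> < 1" using pi_less_4 by (auto simp: \<theta>_def)
  \<comment> \<open>This makes the prime larger than 2, hence odd.\<close>
  have "\<forall>\<^sub>F N in sequentially. 2 < real N powr \<theta>" using \<theta> by real_asymp
  with ex_prime_between_powr[OF \<theta>]
  have "\<forall>\<^sub>F N in sequentially. 2 < real N powr \<theta> \<and> (\<exists>p. prime p \<and> real N powr \<theta> < real p \<and> p \<le> N)"
    by eventually_elim auto
  then obtain K where K: "\<And>N. N \<ge> K \<Longrightarrow> 2 < real N powr \<theta>"
      "\<And>N. N \<ge> K \<Longrightarrow> \<exists>p. prime p \<and> real N powr \<theta> < real p \<and> p \<le> N"
    unfolding eventually_sequentially by blast
  \<comment> \<open>The first entry serves N >= K: the term 2 pi undoes the shift by 2 in the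
    definition of \<open>y\<close>, ln 2 comes from y/2 <= N, and 1/3 from n >= p/3. The second
    serves N < K, where y < K + 1.\<close>
  define c where "c = min (exp (- \<theta> * (2 * pi + ln 2)) / 3) (exp (- \<theta> * (2 * pi + ln (real K + 1))))"
  have ex: "\<exists>n. A_norm (integer_mod_group (2 * n + 1)) (\<lambda>x. of_int (?f n x)) \<le> M \<and>
      prime (2 * n + 1) \<and> real n \<ge> c * exp (pi\<^sup>2 / 4 * M)" if "M \<ge> 1" for M
  proof -
    \<comment> \<open>Chosen so that 2 + ln y / pi = M, where 2 + ln p / pi is the bound on the
      algebra norm for the prime p <= y.\<close>
    define y where "y = exp (pi * (M - 2))"
    define N where "N = nat \<lfloor>y\<rfloor>"
    have y: "y > 0" "real N \<le> y" "y < real N + 1" by (auto simp: y_def N_def)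
    have exponent: "pi\<^sup>2 / 4 * M = \<theta> * (ln y + 2 * pi)"
      by (simp add: \<theta>_def y_def power2_eq_square field_simps)
    show ?thesis
    proof (cases "N \<ge> K")
      case True
      obtain p where p: "prime p" "real N powr \<theta> < real p" "p \<le> N"
        using K(2)[OF True] by blast
      have "p > 2" using p(2) K(1)[OF True] by linarith
      then obtain n where n: "p = 2 * n + 1"
        using prime_odd_nat[OF p(1)] by (auto elim: oddE)
      have "A_norm (integer_mod_group p) (\<lambda>x. of_int (?f n x))
          \<le> (real n + (\<Sum>s=1..n. 1 / cos (pi * real s / real p))) / real p"
        using A_norm_interval_le[of n] by (simp add: n)
      also have "\<dots> \<le> (real p / 2 + real p * (3 / 2 + ln (real p) / pi)) / real p"
        using sum_inverse_cos_le[of n] by (intro divide_right_mono add_mono) (auto simp: n)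
      also have "\<dots> = 2 + ln (real p) / pi"
        using \<open>p > 2\<close> by (simp add: field_simps)
      also have "\<dots> \<le> 2 + ln y / pi"
        using p(3) y(1,2) \<open>p > 2\<close> by (intro add_mono divide_right_mono) auto
      also have "\<dots> = M" by (simp add: y_def)
      finally have "A_norm (integer_mod_group p) (\<lambda>x. of_int (?f n x)) \<le> M" .
      moreover have "c * exp (pi\<^sup>2 / 4 * M) \<le> real n"
      proof -
        have "c * exp (pi\<^sup>2 / 4 * M) \<le> exp (- \<theta> * (2 * pi + ln 2)) / 3 * exp (pi\<^sup>2 / 4 * M)"
          by (intro mult_right_mono) (auto simp: c_def)
        also have "\<dots> = exp (\<theta> * (ln y - ln 2)) / 3"
          unfolding exponent by (simp add: algebra_simps flip: exp_add)
        also have "\<dots> = (y / 2) powr \<theta> / 3"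
          using y(1) by (simp add: powr_def ln_div)
        also have "\<dots> \<le> real N powr \<theta> / 3"
          using y p(3) \<open>p > 2\<close> \<theta> by (intro divide_right_mono powr_mono2) auto
        also have "\<dots> \<le> real n"
          using p(2) n \<open>p > 2\<close> by simp
        finally show ?thesis .
      qed
      ultimately show ?thesis using p(1) n by blast
    next
      case False
      \<comment> \<open>For small M the group of order 3 and the indicator of a point suffice: the
        norm bound is (1 + 1/cos(pi/3))/3 = 1 <= M, and c is small enough for the target to be at
        most n = 1.\<close>
      have "A_norm (integer_mod_group (2 * 1 + 1)) (\<lambda>x. of_int (?f 1 x)) \<le> 1"
        using A_norm_interval_le[of 1] by (simp add: cos_60)
      moreover have "c * exp (pi\<^sup>2 / 4 * M) \<le> real 1"
      proof -
        have "c * exp (pi\<^sup>2 / 4 * M) \<le> exp (- \<theta> * (2 * pi + ln (real K + 1))) * exp (pi\<^sup>2 / 4 * M)"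
          by (intro mult_right_mono) (auto simp: c_def)
        also have "\<dots> = exp (\<theta> * (ln y - ln (real K + 1)))"
          unfolding exponent by (simp add: algebra_simps flip: exp_add)
        also have "\<dots> \<le> exp 0"
          using y False \<theta> by (subst exp_le_cancel_iff) (simp add: mult_le_0_iff)
        finally show ?thesis by simp
      qed
      moreover have "prime (2 * 1 + 1 :: nat)" by simp
      ultimately show ?thesis using that by (intro exI[of _ 1]) linarith
    qed
  qed
  have "c > 0" by (simp add: c_def)
  show ?thesis
  proof (intro exI[of _ c] conjI allI impI)
    fix M :: real assume "M \<ge> 1"
    from ex[OF this] obtain n where n:
      "A_norm (integer_mod_group (2 * n + 1)) (\<lambda>x. of_int (?f n x)) \<le> M"
      "prime (2 * n + 1)" "real n \<ge> c * exp (pi\<^sup>2 / 4 * M)"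
      by blast
    show "\<exists>(G :: int monoid) (f :: int \<Rightarrow> int). comm_group G \<and> finite (carrier G) \<and>
        A_norm G (\<lambda>x. of_int (f x)) \<le> M \<and>
        (\<forall>z :: int set \<Rightarrow> int. (\<forall>x\<in>carrier G. f x = (\<Sum>W\<in>all_cosets G. z W * indicator W x)) \<longrightarrow>
          l1_norm G z \<ge> c * exp (pi\<^sup>2 / 4 * M))"
    proof (rule exI[of _ "integer_mod_group (2 * n + 1)"], rule exI[of _ "?f n"], intro conjI allI impI)
      fix z :: "int set \<Rightarrow> int"
      assume "\<forall>x\<in>carrier (integer_mod_group (2 * n + 1)).
        ?f n x = (\<Sum>W\<in>all_cosets (integer_mod_group (2 * n + 1)). z W * indicator W x)"
      from l1_norm_interval_ge[OF n(2) this] n(3)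
      show "l1_norm (integer_mod_group (2 * n + 1)) z \<ge> c * exp (pi\<^sup>2 / 4 * M)"
        by linarith
    qed (use n(1) in \<open>simp_all add: carrier_integer_mod_group\<close>)
  qed fact
qed

end
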